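(* Let $P_{\mathcal G}(q)=\sum_{\pi}q^{|\pi|}$, summed over all integer partitions $\pi$ (including the empty one) in which any two consecutive parts differ by at least $2$, and any two consecutive parts that are both even differ by at least $4$. Then $$P_{\mathcal G}(q)=\sum_{n\ge0}\frac{(-q;q^2)_n\,q^{n^2}}{(q^2;q^2)_n}=\frac{1}{(q;q^8)_\infty(q^4;q^8)_\infty(q^7;q^8)_\infty}.$$
   Context: $(a;q)_n=\prod_{j=0}^{n-1}(1-aq^j)$ and $(a;q)_\infty=\prod_{j\ge0}(1-aq^j)$; $|\pi|$ is the sum of the parts of $\pi$. *)

theory Defs
  imports "HOL-Analysis.Analysis"
begin

definition qpoch :: "complex \<Rightarrow> complex \<Rightarrow> nat \<Rightarrow> complex" where
  "qpoch a q n = (\<Prod>j<n. 1 - a * q ^ j)"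

definition qpoch_inf :: "complex \<Rightarrow> complex \<Rightarrow> complex" where
  "qpoch_inf a q = (\<Prod>j. 1 - a * q ^ j)"

text \<open>Partitions are represented as lists of positive parts in weakly decreasing
  order (here automatically strictly decreasing). The condition: consecutive parts
  differ by at least 2, and by at least 4 if both are even.\<close>
definition G_partition :: "nat list \<Rightarrow> bool" where
  "G_partition xs \<longleftrightarrow> (\<forall>x\<in>set xs. x > 0) \<and>
     successively (\<lambda>a b. a \<ge> b + 2 \<and> (even a \<and> even b \<longrightarrow> a \<ge> b + 4)) xs"

end

theory Submission
  imports Defs
begin

text \<open>Consider the recurrence \<open>A\<^sub>m = (1 + q\<^bsup>2m+1\<^esup>) A\<^bsub>m+1\<^esub> + q\<^bsup>2m+2\<^esup> A\<^bsub>m+2\<^esub>\<close>. It has at most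
  one solution tending to \<open>1\<close>. Removing a smallest part \<open>2m+1\<close> or \<open>2m+2\<close> shows that it is solved by
  the generating functions of the admissible partitions with all parts greater than \<open>2m\<close>; comparing
  coefficients shows the same for the sums \<open>\<Sum>\<^sub>n (-q;q\<^sup>2)\<^sub>n q^(n\<^sup>2+2mn) / (q\<^sup>2;q\<^sup>2)\<^sub>n\<close>. A third solution is Andrews'
  very-well-poised series evaluated at \<open>x = q\<^bsup>2m\<^esup>\<close>, for which the recurrence is verified by an explicit
  telescoping certificate. At \<open>m = 0\<close> this series is the theta series \<open>\<Sum>\<^sub>j (-1)\<^sup>j q^(4j\<^sup>2-j)\<close>, which the Jacobi
  triple product turns into the infinite product.\<close>

subsection \<open>q-Pochhammer symbols and the recurrence\<close>

lemma qpoch_0 [simp]: "qpoch a q 0 = 1"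
  by (simp add: qpoch_def)

lemma qpoch_Suc: "qpoch a q (Suc n) = qpoch a q n * (1 - a * q ^ n)"
  by (simp add: qpoch_def)

lemma convergent_prod_qpoch:
  assumes "norm q < 1"
  shows "convergent_prod (\<lambda>j. 1 - a * q ^ j :: complex)"
proof -
  have "summable (\<lambda>j. norm (a * q ^ j))"
    using assms by (simp add: norm_mult norm_power summable_mult)
  then have "abs_convergent_prod (\<lambda>j. 1 - a * q ^ j)"
    by (intro summable_imp_abs_convergent_prod) simp
  then show ?thesis
    by (rule abs_convergent_prod_imp_convergent_prod)
qed

lemma qpoch_LIMSEQ:
  assumes "norm q < 1"
  shows "qpoch a q \<longlonglongrightarrow> qpoch_inf a q"
  using has_prod_imp_tendsto'[OF convergent_prod_has_prod[OF convergent_prod_qpoch[OF assms, of a]]]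
  by (simp add: qpoch_def[abs_def] qpoch_inf_def)

lemma one_minus_mult_power_nonzero:
  fixes a q :: complex
  assumes "norm q < 1" "norm a < 1"
  shows "1 - a * q ^ j \<noteq> 0"
proof
  assume "1 - a * q ^ j = 0"
  then have "norm (a * q ^ j) = 1" by simp
  moreover have "norm (a * q ^ j) \<le> norm a * 1"
    unfolding norm_mult norm_power using assms by (intro mult_left_mono power_le_one) auto
  ultimately show False using assms by simp
qed

lemma qpoch_nonzero:
  assumes "norm q < 1" "norm a < 1"
  shows "qpoch a q n \<noteq> 0"
  using one_minus_mult_power_nonzero[OF assms] by (simp add: qpoch_def)

lemma qpoch_inf_nonzero:
  assumes "norm q < 1" "norm a < 1"
  shows "qpoch_inf a q \<noteq> 0"
  unfolding qpoch_inf_def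
  using convergent_prod_qpoch one_minus_mult_power_nonzero assms by (intro prodinf_nonzero) auto

lemma qpoch_bounded:
  assumes "norm q < 1"
  obtains K where "K > 0" "\<And>n. norm (qpoch a q n) \<le> K"
  using convergent_imp_Bseq[OF convergentI[OF qpoch_LIMSEQ[OF assms, of a]]] that
  unfolding Bseq_def by blast

text \<open>The limit \<open>qpoch_inf a q\<close> is nonzero, so the inverses converge too. Such
  bounds, uniform in \<open>n\<close>, feed the dominating series for the limit interchanges
  below.\<close>

lemma inverse_qpoch_bounded:
  assumes "norm q < 1" "norm a < 1"
  obtains K where "K > 0" "\<And>n. norm (inverse (qpoch a q n)) \<le> K"
  using convergent_imp_Bseq[OF convergentI[OF tendsto_inverse[OF qpoch_LIMSEQ[of q a]]]] that
    assms qpoch_inf_nonzero[OF assms] unfolding Bseq_def by blast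

text \<open>Sorting the factors by the parity of the exponent is exact for the partial products of
  length \<open>2 * n\<close>; both sides are limits of that one sequence.\<close>

lemma qpoch_inf_split_parity:
  assumes "norm q < 1"
  shows "qpoch_inf a q = qpoch_inf a (q\<^sup>2) * qpoch_inf (a * q) (q\<^sup>2)"
proof (rule LIMSEQ_unique)
  have *: "qpoch a q (2 * n) = qpoch a (q\<^sup>2) n * qpoch (a * q) (q\<^sup>2) n" for n
    by (induction n) (simp_all add: qpoch_Suc power_mult[symmetric] mult_ac)
  have q2: "norm (q\<^sup>2) < 1"
    using assms by (simp add: norm_power power_less_one_iff)
  show "(\<lambda>n. qpoch a q (2 * n)) \<longlonglongrightarrow> qpoch_inf a (q\<^sup>2) * qpoch_inf (a * q) (q\<^sup>2)"
    unfolding * by (intro tendsto_mult qpoch_LIMSEQ q2)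
  show "(\<lambda>n. qpoch a q (2 * n)) \<longlonglongrightarrow> qpoch_inf a q"
    using qpoch_LIMSEQ[OF assms]
    by (rule filterlim_compose) (auto intro: filterlim_subseq simp: strict_mono_def)
qed

lemma qpoch_inf_mult_uminus:
  assumes "norm q < 1"
  shows "qpoch_inf (-a) q * qpoch_inf a q = qpoch_inf (a\<^sup>2) (q\<^sup>2)"
proof (rule LIMSEQ_unique)
  have *: "qpoch (-a) q n * qpoch a q n = qpoch (a\<^sup>2) (q\<^sup>2) n" for n
  proof (induction n)
    case (Suc n)
    have "qpoch (-a) q (Suc n) * qpoch a q (Suc n) =
      (qpoch (-a) q n * qpoch a q n) * (1 - a\<^sup>2 * (q\<^sup>2) ^ n)"
      by (simp add: qpoch_Suc algebra_simps power2_eq_square power_mult_distrib)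
    then show ?case by (simp add: Suc qpoch_Suc)
  qed simp
  show "(\<lambda>n. qpoch (-a) q n * qpoch a q n) \<longlonglongrightarrow> qpoch_inf (-a) q * qpoch_inf a q"
    by (intro tendsto_mult qpoch_LIMSEQ assms)
  show "(\<lambda>n. qpoch (-a) q n * qpoch a q n) \<longlonglongrightarrow> qpoch_inf (a\<^sup>2) (q\<^sup>2)"
    unfolding * using assms by (intro qpoch_LIMSEQ) (simp add: norm_power power_less_one_iff)
qed

text \<open>The difference of two solutions solves the same recurrence and tends to 0. Comparison
  with every positive multiple of a supersolution \<open>E\<close> forces it to vanish.\<close>

lemma gg_recurrence_unique:
  fixes A B :: "nat \<Rightarrow> complex"
  assumes q: "norm q < 1"
    and A: "\<And>m. A m = (1 + q ^ (2*m+1)) * A (m+1) + q ^ (2*m+2) * A (m+2)" "A \<longlonglongrightarrow> L"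
    and B: "\<And>m. B m = (1 + q ^ (2*m+1)) * B (m+1) + q ^ (2*m+2) * B (m+2)" "B \<longlonglongrightarrow> L"
  shows "A m = B m"
proof -
  define D where "D = (\<lambda>m. A m - B m)"
  define r where "r = norm q"
  have r: "0 \<le> r" "r < 1" using q by (auto simp: r_def)
  have D: "D k = (1 + q ^ (2*k+1)) * D (k+1) + q ^ (2*k+2) * D (k+2)" for k
    unfolding D_def A(1)[of k] B(1)[of k] by (simp add: algebra_simps)
  have D0: "D \<longlonglongrightarrow> 0"
    unfolding D_def using tendsto_diff[OF A(2) B(2)] by simp
  \<comment> \<open>\<open>E\<close> is a supersolution of the recurrence, so smallness of \<open>D\<close> propagates down from infinity.\<close>
  define E where "E = (\<lambda>k. exp (r ^ (2*k+1) / (1 - r)))"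
  have E_ge: "E k \<ge> 1" for k
    using r by (simp add: E_def)
  have E_rec: "(1 + r ^ (2*k+1)) * E (k+1) + r ^ (2*k+2) * E (k+2) \<le> E k" for k
  proof -
    have "E (k+2) \<le> E (k+1)"
      unfolding E_def exp_le_cancel_iff using r by (intro divide_right_mono power_decreasing) auto
    then have "(1 + r ^ (2*k+1)) * E (k+1) + r ^ (2*k+2) * E (k+2)
        \<le> (1 + r ^ (2*k+1)) * E (k+1) + r ^ (2*k+2) * E (k+1)"
      using r by (intro add_left_mono mult_left_mono) auto
    also have "\<dots> = (1 + (r ^ (2*k+1) + r ^ (2*k+2))) * E (k+1)"
      by (simp add: algebra_simps)
    also have "\<dots> \<le> exp (r ^ (2*k+1) + r ^ (2*k+2)) * E (k+1)"
      using E_ge[of "k+1"] by (intro mult_right_mono exp_ge_add_one_self) auto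
    \<comment> \<open>The exponent of \<open>E k\<close> is the geometric tail of the powers
      \<open>r ^ i\<close> with \<open>i \<ge> 2*k+1\<close>; passing from \<open>k+1\<close> to
      \<open>k\<close> adds exactly its first two terms.\<close>
    also have "\<dots> = E k"
      using r unfolding E_def exp_add[symmetric]
      by (intro arg_cong[where f = exp]) (simp add: field_simps)
    finally show ?thesis .
  qed
  have bound: "norm (D m) \<le> \<epsilon> * E m" if \<epsilon>: "\<epsilon> > 0" for \<epsilon>
  proof -
    obtain N where N: "norm (D n) \<le> \<epsilon>" if "n \<ge> N" for n
      using LIMSEQ_D[OF D0 \<epsilon>] by fastforce
    have "norm (D k) \<le> \<epsilon> * E k" for k
    \<comment> \<open>Descent from \<open>N\<close>: from \<open>N\<close> on the bound holds
      because \<open>E\<close> is at least 1, and below \<open>N\<close> it follows from the bounds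
      at \<open>k+1\<close> and \<open>k+2\<close>.\<close>
    proof (induction "N - k" arbitrary: k rule: less_induct)
      case less
      show ?case
      proof (cases "N \<le> k")
        case True
        have "norm (D k) \<le> \<epsilon> * 1" using N[OF True] by simp
        also have "\<dots> \<le> \<epsilon> * E k" using \<epsilon> E_ge by (intro mult_left_mono) auto
        finally show ?thesis .
      next
        case False
        have "norm (D k) \<le> norm (1 + q ^ (2*k+1)) * norm (D (k+1)) + r ^ (2*k+2) * norm (D (k+2))"
          unfolding D[of k] r_def norm_power[symmetric] norm_mult[symmetric] by (rule norm_triangle_ineq)
        also have "\<dots> \<le> (1 + r ^ (2*k+1)) * (\<epsilon> * E (k+1)) + r ^ (2*k+2) * (\<epsilon> * E (k+2))"
          using r False less.hyps[of "k+1"] less.hyps[of "k+2"]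
            norm_triangle_ineq[of 1 "q ^ (2*k+1)"]
          by (intro add_mono mult_mono) (auto simp: r_def norm_power norm_mult)
        also have "\<dots> = \<epsilon> * ((1 + r ^ (2*k+1)) * E (k+1) + r ^ (2*k+2) * E (k+2))"
          by (simp add: algebra_simps)
        also have "\<dots> \<le> \<epsilon> * E k"
          using \<epsilon> E_rec by (intro mult_left_mono) auto
        finally show ?thesis .
      qed
    qed
    then show ?thesis .
  qed
  have "norm (D m) \<le> 0 + \<epsilon>" if "\<epsilon> > 0" for \<epsilon>
    using bound[of "\<epsilon> / E m"] that E_ge[of m] by simp
  then have "norm (D m) \<le> 0" by (rule field_le_epsilon)
  then show ?thesis by (simp add: D_def)
qed

subsection \<open>The Jacobi triple product\<close>

text \<open>The extension by zero to negative \<open>k\<close> makes the Gaussian binomials below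
  vanish outside their range.\<close>

definition inv_qfact :: "complex \<Rightarrow> int \<Rightarrow> complex" where
  "inv_qfact p k = (if k < 0 then 0 else 1 / qpoch p p (nat k))"

lemma inv_qfact_minus_one:
  assumes "norm p < 1"
  shows "inv_qfact p (int n - 1) = (1 - p ^ n) * inv_qfact p (int n)"
proof (cases n)
  case (Suc k)
  show ?thesis
    using qpoch_nonzero[OF assms assms, of k] one_minus_mult_power_nonzero[OF assms assms, of k]
    by (simp add: Suc inv_qfact_def qpoch_Suc nat_add_distrib)
qed (simp add: inv_qfact_def)

text \<open>Truncated subtraction is harmless: for \<open>n = 0\<close> the factor
  \<open>1 - p ^ n\<close> vanishes, and for \<open>n = 1\<close> the factor
  \<open>1 - p ^ (n - 1)\<close> does, matching the extension by zero.\<close>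

lemma inv_qfact_minus_two:
  assumes "norm p < 1"
  shows "inv_qfact p (int n - 2) = (1 - p ^ (n - 1)) * (1 - p ^ n) * inv_qfact p (int n)"
proof (cases n)
  case (Suc k)
  have "inv_qfact p (int n - 2) = (1 - p ^ k) * inv_qfact p (int k)"
    unfolding inv_qfact_minus_one[OF assms, symmetric] Suc by (simp add: algebra_simps)
  also have "inv_qfact p (int k) = (1 - p ^ n) * inv_qfact p (int n)"
    unfolding inv_qfact_minus_one[OF assms, symmetric] Suc by simp
  finally show ?thesis
    by (simp only: Suc diff_Suc_1 mult.assoc)
qed (simp add: inv_qfact_def)

text \<open>The Gaussian binomial coefficient \<open>[2N, N + j]\<close>, extended by zero.\<close>

definition central_qbinomial :: "complex \<Rightarrow> nat \<Rightarrow> int \<Rightarrow> complex" where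
  "central_qbinomial p N j = qpoch p p (2 * N) * inv_qfact p (int N - j) * inv_qfact p (int N + j)"

lemma central_qbinomial_eq_0: "\<bar>j\<bar> > int N \<Longrightarrow> central_qbinomial p N j = 0"
  by (auto simp: central_qbinomial_def inv_qfact_def)

text \<open>Two q-Pascal steps at once, from row \<open>2 * N\<close> to row
  \<open>2 * N + 2\<close>. All four coefficients are multiples of
  \<open>inv_qfact p (int A) * inv_qfact p (int B)\<close>, so that only the polynomial identity
  \<open>expand\<close> remains.\<close>

lemma central_qbinomial_Suc:
  assumes p: "norm p < 1" and j: "\<bar>j\<bar> \<le> int N + 1"
  shows "central_qbinomial p (Suc N) j =
    p ^ nat (int N + 1 - j) * central_qbinomial p N (j - 1)
    + (1 + p ^ (2 * N + 1)) * central_qbinomial p N j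
    + p ^ nat (int N + 1 + j) * central_qbinomial p N (j + 1)"
proof -
  define A B where "A = nat (int N + 1 - j)" and "B = nat (int N + 1 + j)"
  have A: "int N + 1 - j = int A" and B: "int N + 1 + j = int B"
    using j by (auto simp: A_def B_def)
  have AB: "A + B = 2 * N + 2"
    using A B by linarith
  have idx: "int (Suc N) - j = int A" "int (Suc N) + j = int B"
      "int N - (j - 1) = int A" "int N + (j - 1) = int B - 2"
      "int N - j = int A - 1" "int N + j = int B - 1"
      "int N - (j + 1) = int A - 2" "int N + (j + 1) = int B"
    using A B by auto
  have qpoch_rec: "qpoch p p (2 * Suc N) = qpoch p p (2 * N) * ((1 - p ^ (2*N+1)) * (1 - p ^ (2*N+2)))"
    by (simp add: qpoch_Suc mult_ac)
  have expand: "(1 - p ^ (2*N+1)) * (1 - p ^ (2*N+2)) =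
      p ^ A * ((1 - p ^ (B - 1)) * (1 - p ^ B)) + (1 + p ^ (2*N+1)) * ((1 - p ^ A) * (1 - p ^ B))
      + p ^ B * ((1 - p ^ (A - 1)) * (1 - p ^ A))"
  proof (cases "A = 0 \<or> B = 0")
    case True
    then show ?thesis using AB by auto
  next
    case False
    then obtain A' B' where AB': "A = Suc A'" "B = Suc B'"
      by (metis not0_implies_Suc)
    then have *: "2 * N = A' + B'" using AB by simp
    have pows: "p ^ (2*N+1) = p * p ^ A' * p ^ B'" "p ^ (2*N+2) = p * p * p ^ A' * p ^ B'"
      by (simp_all add: * power_add)
    show ?thesis
      unfolding AB' pows by (simp add: algebra_simps)
  qed
  show ?thesis
    unfolding central_qbinomial_def A B nat_int idx inv_qfact_minus_one[OF p] inv_qfact_minus_two[OF p]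
      qpoch_rec expand
    by (simp only: distrib_left distrib_right mult_ac)
qed

section \<open>Theta terms and the finite form of the triple product\<close>

definition tri :: "int \<Rightarrow> int" where
  "tri j = j * (j + 1) div 2"

lemma tri_double: "2 * tri j = j * (j + 1)"
  by (simp add: tri_def)

lemma tri_nonneg: "tri j \<ge> 0"
proof -
  have "j * (j + 1) \<ge> 0" by (cases "j \<ge> 0") (auto intro: mult_nonneg_nonneg mult_nonpos_nonpos)
  then show ?thesis by (simp add: tri_def)
qed

lemma tri_step: "tri j = tri (j - 1) + j"
  using tri_double[of j] tri_double[of "j - 1"] by (simp add: algebra_simps)

text \<open>The general term of Ramanujan's theta function \<open>f(a, b)\<close>.\<close>

definition theta_term :: "complex \<Rightarrow> complex \<Rightarrow> int \<Rightarrow> complex" where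
  "theta_term a b j = a ^ nat (tri j) * b ^ nat (tri (j - 1))"

text \<open>With \<open>p = a * b\<close>, this turns a power of \<open>p\<close> in
  \<open>central_qbinomial_Suc\<close> into a shift of the summation index, with a prefactor free of
  \<open>j\<close>. The hypothesis keeps \<open>nat\<close> from truncating.\<close>

lemma theta_term_down:
  assumes "j \<le> int N + 1"
  shows "theta_term a b j * (a * b) ^ nat (int N + 1 - j) = a ^ (N + 1) * b ^ N * theta_term a b (j - 1)"
proof -
  have "nat (tri j) + nat (int N + 1 - j) = N + 1 + nat (tri (j - 1))"
    using assms tri_step[of j] tri_nonneg[of j] tri_nonneg[of "j - 1"] by linarith
  moreover have "nat (tri (j - 1)) + nat (int N + 1 - j) = N + nat (tri (j - 1 - 1))"
    using assms tri_step[of "j - 1"] tri_nonneg[of "j - 1"] tri_nonneg[of "j - 1 - 1"] by linarith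
  ultimately have "a ^ nat (tri j) * a ^ nat (int N + 1 - j) = a ^ (N + 1) * a ^ nat (tri (j - 1))"
    "b ^ nat (tri (j - 1)) * b ^ nat (int N + 1 - j) = b ^ N * b ^ nat (tri (j - 1 - 1))"
    unfolding power_add[symmetric] by simp_all
  note eqs = this
  have "theta_term a b j * (a * b) ^ nat (int N + 1 - j) =
      (a ^ nat (tri j) * a ^ nat (int N + 1 - j)) * (b ^ nat (tri (j - 1)) * b ^ nat (int N + 1 - j))"
    by (simp only: theta_term_def power_mult_distrib mult_ac)
  also have "\<dots> = a ^ (N + 1) * b ^ N * theta_term a b (j - 1)"
    unfolding eqs by (simp only: theta_term_def mult_ac)
  finally show ?thesis .
qed

lemma theta_term_up:
  assumes "- j \<le> int N + 1"
  shows "theta_term a b j * (a * b) ^ nat (int N + 1 + j) = a ^ N * b ^ (N + 1) * theta_term a b (j + 1)"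
proof -
  have "nat (tri j) + nat (int N + 1 + j) = N + nat (tri (j + 1))"
    using assms tri_step[of "j + 1"] tri_nonneg[of j] tri_nonneg[of "j + 1"] by simp
  moreover have "nat (tri (j - 1)) + nat (int N + 1 + j) = N + 1 + nat (tri j)"
    using assms tri_step[of j] tri_nonneg[of "j - 1"] tri_nonneg[of j] by linarith
  ultimately have "a ^ nat (tri j) * a ^ nat (int N + 1 + j) = a ^ N * a ^ nat (tri (j + 1))"
    "b ^ nat (tri (j - 1)) * b ^ nat (int N + 1 + j) = b ^ (N + 1) * b ^ nat (tri j)"
    unfolding power_add[symmetric] by simp_all
  note eqs = this
  have "theta_term a b j * (a * b) ^ nat (int N + 1 + j) =
      (a ^ nat (tri j) * a ^ nat (int N + 1 + j)) * (b ^ nat (tri (j - 1)) * b ^ nat (int N + 1 + j))"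
    by (simp only: theta_term_def power_mult_distrib mult_ac)
  also have "\<dots> = a ^ N * b ^ (N + 1) * theta_term a b (j + 1)"
    unfolding eqs by (simp only: theta_term_def mult_ac add_diff_cancel_right')
  finally show ?thesis .
qed

text \<open>Induction on \<open>N\<close>: each summand for \<open>Suc N\<close> is a combination of
  \<open>t (j - 1)\<close>, \<open>t j\<close> and \<open>t (j + 1)\<close> with coefficients free
  of \<open>j\<close>. All three shifted sums equal the old sum \<open>T\<close>, and the
  coefficients add up to the product of the two new factors.\<close>

lemma finite_jacobi_triple_product:
  assumes "norm (a * b) < 1"
  shows "(\<Sum>j\<in>{-int N..int N}. theta_term a b j * central_qbinomial (a * b) N j) =
    qpoch (-a) (a * b) N * qpoch (-b) (a * b) N"
proof (induction N)
  case 0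
  show ?case by (simp add: theta_term_def central_qbinomial_def tri_def inv_qfact_def)
next
  case (Suc N)
  define p where "p = a * b"
  define t where "t = (\<lambda>j. theta_term a b j * central_qbinomial p N j)"
  define S where "S = {- int (Suc N)..int (Suc N)}"
  define T where "T = sum t {- int N..int N}"
  have t0: "t j = 0" if "\<bar>j\<bar> > int N" for j
    using that by (simp add: t_def central_qbinomial_eq_0)
  have sum_T: "(\<Sum>j\<in>S. t j) = T"
    unfolding T_def S_def by (intro sum.mono_neutral_right) (auto intro!: t0)
  have "(\<Sum>j\<in>S. t (j - 1)) = (\<Sum>j\<in>{- int N - 2..int N}. t j)"
    by (intro sum.reindex_bij_witness[of _ "\<lambda>j. j + 1" "\<lambda>j. j - 1"]) (auto simp: S_def)
  also have "\<dots> = T"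
    unfolding T_def by (intro sum.mono_neutral_right) (auto intro!: t0)
  finally have sum_down: "(\<Sum>j\<in>S. t (j - 1)) = T" .
  have "(\<Sum>j\<in>S. t (j + 1)) = (\<Sum>j\<in>{- int N..int N + 2}. t j)"
    by (intro sum.reindex_bij_witness[of _ "\<lambda>j. j - 1" "\<lambda>j. j + 1"]) (auto simp: S_def)
  also have "\<dots> = T"
    unfolding T_def by (intro sum.mono_neutral_right) (auto intro!: t0)
  finally have sum_up: "(\<Sum>j\<in>S. t (j + 1)) = T" .
  have "theta_term a b j * central_qbinomial p (Suc N) j =
      a ^ (N + 1) * b ^ N * t (j - 1) + (1 + p ^ (2 * N + 1)) * t j + a ^ N * b ^ (N + 1) * t (j + 1)"
    if "j \<in> S" for j
  proof -
    have j: "\<bar>j\<bar> \<le> int N + 1" "j \<le> int N + 1" "- j \<le> int N + 1"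
      using that by (auto simp: S_def)
    have "theta_term a b j * central_qbinomial p (Suc N) j =
       theta_term a b j * p ^ nat (int N + 1 - j) * central_qbinomial p N (j - 1)
       + (1 + p ^ (2 * N + 1)) * t j
       + theta_term a b j * p ^ nat (int N + 1 + j) * central_qbinomial p N (j + 1)"
      using assms j(1) by (subst central_qbinomial_Suc) (auto simp: p_def t_def algebra_simps)
    also have "\<dots> = a ^ (N + 1) * b ^ N * t (j - 1) + (1 + p ^ (2 * N + 1)) * t j
       + a ^ N * b ^ (N + 1) * t (j + 1)"
      unfolding p_def theta_term_down[OF j(2)] theta_term_up[OF j(3)] t_def by (simp add: mult_ac)
    finally show ?thesis .
  qed
  then have "(\<Sum>j\<in>S. theta_term a b j * central_qbinomial p (Suc N) j) =
      (\<Sum>j\<in>S. a ^ (N + 1) * b ^ N * t (j - 1) + (1 + p ^ (2 * N + 1)) * t j + a ^ N * b ^ (N + 1) * t (j + 1))"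
    by (rule sum.cong[OF refl])
  also have "\<dots> = a ^ (N + 1) * b ^ N * T + (1 + p ^ (2 * N + 1)) * T + a ^ N * b ^ (N + 1) * T"
    by (simp only: sum.distrib sum_distrib_left[symmetric] sum_T sum_down sum_up)
  also have "\<dots> = T * ((1 + a * p ^ N) * (1 + b * p ^ N))"
  proof -
    have "p ^ (2 * N + 1) = a * b * (a ^ N * b ^ N) * (a ^ N * b ^ N)"
      unfolding p_def mult_2 power_add by (simp add: power_mult_distrib mult_ac)
    moreover have "p ^ N = a ^ N * b ^ N"
      by (simp add: p_def power_mult_distrib)
    ultimately show ?thesis
      by (simp only:) (simp add: algebra_simps)
  qed
  also have "T = qpoch (-a) p N * qpoch (-b) p N"
    using Suc.IH by (simp add: T_def t_def p_def)
  finally show ?case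
    by (simp add: S_def p_def qpoch_Suc mult_ac)
qed

text \<open>This pairing of \<open>n\<close> with \<open>- n - 1\<close> makes the two-sided theta
  series one-sided; it is the one that \<open>gg_term_0_eq_theta\<close> produces.\<close>

lemma sum_symmetric_int_pairs:
  "(\<Sum>j\<in>{-int N - 1..int N}. h j) = (\<Sum>n\<le>N. h (int n) + h (- int n - 1))"
proof (induction N)
  case 0
  have "{-1..0::int} = {-1, 0}" by auto
  then show ?case by (simp add: add.commute)
next
  case (Suc N)
  have "{- int (Suc N) - 1..int (Suc N)} =
      insert (int (Suc N)) (insert (- int (Suc N) - 1) {- int N - 1..int N})"
    by auto
  then show ?case using Suc by (simp add: add_ac)
qed

text \<open>The finite form with \<open>N\<close> tending to infinity: each central coefficient
  tends to \<open>1 / L\<close>, and Tannery's theorem with the geometric majorant \<open>M\<close>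
  moves the limit inside the sum.\<close>

theorem jacobi_triple_product:
  assumes a: "norm a < 1" and b: "norm b < 1"
  shows "(\<lambda>n. theta_term a b (int n) + theta_term a b (- int n - 1)) sums
    (qpoch_inf (a * b) (a * b) * qpoch_inf (-a) (a * b) * qpoch_inf (-b) (a * b))"
proof -
  define p where "p = a * b"
  have p: "norm p < 1"
    using mult_strict_mono'[OF a b] by (simp add: p_def norm_mult)
  define L where "L = qpoch_inf p p"
  have L: "L \<noteq> 0" using p by (simp add: L_def qpoch_inf_nonzero)
  define v where "v = theta_term a b"
  define h where "h = (\<lambda>n N. v (int n) * central_qbinomial p N (int n)
    + v (- int n - 1) * central_qbinomial p N (- int n - 1))"
  have fin: "(\<Sum>n. h n N) = qpoch (-a) p N * qpoch (-b) p N" for N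
  proof -
    have "(\<Sum>n. h n N) = (\<Sum>n\<le>N. h n N)"
      by (intro suminf_finite) (auto simp: h_def central_qbinomial_eq_0)
    also have "\<dots> = (\<Sum>j\<in>{-int N - 1..int N}. v j * central_qbinomial p N j)"
      unfolding h_def by (rule sum_symmetric_int_pairs[symmetric])
    \<comment> \<open>The pairing includes the extra index \<open>-int N - 1\<close>, where the
      coefficient is zero.\<close>
    also have "\<dots> = (\<Sum>j\<in>{-int N..int N}. v j * central_qbinomial p N j)"
      by (intro sum.mono_neutral_right) (auto intro!: central_qbinomial_eq_0)
    also have "\<dots> = qpoch (-a) p N * qpoch (-b) p N"
      using finite_jacobi_triple_product[of a b N] p by (simp add: p_def v_def)
    finally show ?thesis .
  qed
  obtain K1 where K1: "K1 > 0" "\<And>n. norm (qpoch p p n) \<le> K1"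
    using qpoch_bounded[OF p] by blast
  obtain K2 where K2: "K2 > 0" "\<And>n. norm (inverse (qpoch p p n)) \<le> K2"
    using inverse_qpoch_bounded[OF p p] by blast
  define K where "K = K1 * K2 * K2"
  have inv_bound: "norm (inv_qfact p k) \<le> K2" for k
    using K2(1) K2(2)[of "nat k"] by (simp add: inv_qfact_def divide_inverse)
  have cq_bound: "norm (central_qbinomial p N j) \<le> K" for N j
    unfolding central_qbinomial_def norm_mult K_def
    using K1 K2 inv_bound by (intro mult_mono) auto
  have lim_inv: "(\<lambda>N. inv_qfact p (int N + j)) \<longlonglongrightarrow> 1 / L" for j
  proof -
    have "(\<lambda>n. 1 / qpoch p p n) \<longlonglongrightarrow> 1 / L"
      using L qpoch_LIMSEQ[OF p] by (intro tendsto_intros) (auto simp: L_def)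
    moreover have "filterlim (\<lambda>N. nat (int N + j)) sequentially sequentially"
      unfolding filterlim_at_top
    proof
      fix Z
      show "\<forall>\<^sub>F N in sequentially. Z \<le> nat (int N + j)"
        by (rule eventually_sequentiallyI[of "nat (int Z - j)"]) linarith
    qed
    ultimately have "(\<lambda>N. 1 / qpoch p p (nat (int N + j))) \<longlonglongrightarrow> 1 / L"
      by (rule filterlim_compose)
    moreover have "\<forall>\<^sub>F N in sequentially. 1 / qpoch p p (nat (int N + j)) = inv_qfact p (int N + j)"
      by (rule eventually_sequentiallyI[of "nat (- j)"]) (auto simp: inv_qfact_def)
    ultimately show ?thesis
      using tendsto_cong by fastforce
  qed
  have lim_cq: "(\<lambda>N. central_qbinomial p N j) \<longlonglongrightarrow> 1 / L" for j
  proof -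
    have "(\<lambda>N. qpoch p p (2 * N)) \<longlonglongrightarrow> L"
      unfolding L_def using qpoch_LIMSEQ[OF p]
      by (rule filterlim_compose) (auto intro: filterlim_subseq simp: strict_mono_def)
    then have "(\<lambda>N. central_qbinomial p N j) \<longlonglongrightarrow> L * (1 / L) * (1 / L)"
      unfolding central_qbinomial_def
      using lim_inv[of "-j"] lim_inv[of j] by (intro tendsto_mult) auto
    then show ?thesis using L by simp
  qed
  have tri_ge: "nat (tri (int n)) \<ge> n" for n
  proof -
    have "int n * (int n + 1) \<ge> 2 * int n"
      by (cases n) (auto simp: algebra_simps)
    then show ?thesis using tri_double[of "int n"] by linarith
  qed
  have v_bound1: "norm (v (int n)) \<le> norm a ^ n" for n
  proof -
    have "norm (v (int n)) \<le> norm a ^ n * 1"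
      unfolding v_def theta_term_def norm_mult norm_power using a b tri_ge
      by (intro mult_mono power_decreasing power_le_one) auto
    then show ?thesis by simp
  qed
  \<comment> \<open>At negative indices the decay comes from the exponent of \<open>b\<close>, which
    is \<open>tri (int (Suc n))\<close> by the symmetry of \<open>tri\<close>.\<close>
  have v_bound2: "norm (v (- int n - 1)) \<le> norm b ^ n" for n
  proof -
    have "tri (- int n - 1 - 1) = tri (int (Suc n))"
      using tri_double[of "- int n - 1 - 1"] tri_double[of "int (Suc n)"] by (simp add: algebra_simps)
    then have "nat (tri (- int n - 1 - 1)) \<ge> n"
      using tri_ge[of "Suc n"] by simp
    then have "norm (v (- int n - 1)) \<le> 1 * norm b ^ n"
      unfolding v_def theta_term_def norm_mult norm_power using a b
      by (intro mult_mono power_decreasing power_le_one) auto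
    then show ?thesis by simp
  qed
  define M where "M = (\<lambda>n. K * (norm a ^ n + norm b ^ n))"
  have "norm (h n N) \<le> norm a ^ n * K + norm b ^ n * K" for n N
    unfolding h_def using v_bound1 v_bound2 cq_bound
    by (intro norm_triangle_le add_mono) (auto simp: norm_mult intro!: mult_mono)
  then have h_bound: "norm (h n N) \<le> M n" for n N
    by (simp add: M_def algebra_simps)
  have "summable M"
    unfolding M_def using a b by (intro summable_mult summable_add) auto
  moreover have "(\<lambda>N. h n N) \<longlonglongrightarrow> (v (int n) + v (- int n - 1)) / L" for n
  proof -
    have "(\<lambda>N. h n N) \<longlonglongrightarrow> v (int n) * (1 / L) + v (- int n - 1) * (1 / L)"
      unfolding h_def by (intro tendsto_intros lim_cq)
    then show ?thesis by (simp add: add_divide_distrib)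
  qed
  ultimately have *: "summable (\<lambda>n. norm ((v (int n) + v (- int n - 1)) / L))"
    "(\<lambda>N. \<Sum>n. h n N) \<longlonglongrightarrow> (\<Sum>n. (v (int n) + v (- int n - 1)) / L)"
    using tannerys_theorem[of h "\<lambda>n. (v (int n) + v (- int n - 1)) / L" sequentially M] h_bound
    by (auto simp: case_prod_unfold)
  have "(\<Sum>n. (v (int n) + v (- int n - 1)) / L) = qpoch_inf (-a) p * qpoch_inf (-b) p"
    using *(2) unfolding fin by (rule LIMSEQ_unique) (intro tendsto_mult qpoch_LIMSEQ p)
  then have "(\<lambda>n. (v (int n) + v (- int n - 1)) / L) sums (qpoch_inf (-a) p * qpoch_inf (-b) p)"
    using summable_sums[OF summable_norm_cancel[OF *(1)]] by simp
  from sums_mult[OF this, of L] show ?thesis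
    using L by (simp add: v_def p_def L_def mult_ac)
qed

subsection \<open>The q-series\<close>

definition gg_coeff :: "complex \<Rightarrow> nat \<Rightarrow> complex" where
  "gg_coeff q n = qpoch (-q) (q\<^sup>2) n * q ^ (n\<^sup>2) / qpoch (q\<^sup>2) (q\<^sup>2) n"

definition gg_series :: "complex \<Rightarrow> nat \<Rightarrow> complex" where
  "gg_series q m = (\<Sum>n. gg_coeff q n * (q ^ (2 * m)) ^ n)"

lemma norm_power2_less_one: "norm (q :: complex) < 1 \<Longrightarrow> norm (q\<^sup>2) < 1"
  by (simp add: norm_power power_less_one_iff)

lemma gg_coeff_Suc:
  assumes "norm q < 1"
  shows "gg_coeff q (Suc n) * (1 - (q\<^sup>2) ^ Suc n) = q ^ (2*n+1) * (1 + q ^ (2*n+1)) * gg_coeff q n"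
proof -
  have "1 - q\<^sup>2 * (q\<^sup>2) ^ n \<noteq> 0" "qpoch (q\<^sup>2) (q\<^sup>2) n \<noteq> 0"
    using one_minus_mult_power_nonzero qpoch_nonzero norm_power2_less_one[OF assms] by blast+
  moreover have "q ^ (Suc n)\<^sup>2 = q ^ n\<^sup>2 * q ^ (2*n+1)"
    unfolding power_add[symmetric] by (intro arg_cong2[where f = "(^)"] refl) (simp add: power2_eq_square)
  moreover have "q * (q\<^sup>2) ^ n = q ^ (2*n+1)"
    by (simp add: power_mult)
  ultimately show ?thesis
    unfolding gg_coeff_def qpoch_Suc by (simp add: divide_simps mult_ac)
qed

lemma gg_coeff_summable:
  assumes q: "norm q < 1"
  shows "summable (\<lambda>n. norm (gg_coeff q n))"
proof -
  obtain K1 where K1: "K1 > 0" "\<And>n. norm (qpoch (-q) (q\<^sup>2) n) \<le> K1"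
    using qpoch_bounded[OF norm_power2_less_one[OF q]] by blast
  obtain K2 where K2: "K2 > 0" "\<And>n. norm (inverse (qpoch (q\<^sup>2) (q\<^sup>2) n)) \<le> K2"
    using inverse_qpoch_bounded norm_power2_less_one[OF q] by metis
  have "norm (gg_coeff q n) \<le> K1 * norm q ^ n * K2" for n
    unfolding gg_coeff_def divide_inverse norm_mult norm_power using K1 K2 q
    by (intro mult_mono power_decreasing) (auto simp: power2_eq_square)
  moreover have "summable (\<lambda>n. K1 * norm q ^ n * K2)"
    using q by (intro summable_mult2 summable_mult) auto
  ultimately show ?thesis
    by (intro summable_comparison_test[of "\<lambda>n. norm (gg_coeff q n)" "\<lambda>n. K1 * norm q ^ n * K2"]) auto
qed

lemma gg_series_summable:
  assumes q: "norm q < 1"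
  shows "summable (\<lambda>n. gg_coeff q n * (q ^ (2 * m)) ^ n)"
proof (rule summable_comparison_test'[OF gg_coeff_summable[OF q]])
  fix n
  show "norm (gg_coeff q n * (q ^ (2 * m)) ^ n) \<le> norm (gg_coeff q n)"
    unfolding norm_mult norm_power using q by (intro mult_right_le_one_le power_le_one) auto
qed

text \<open>Subtracting the series at \<open>m+1\<close> from that at \<open>m\<close> inserts the
  factor \<open>1 - (q\<^sup>2) ^ n\<close>, which by \<open>gg_coeff_Suc\<close> lowers the
  coefficient index by one. The two summands of \<open>q ^ (2*n+1) * (1 + q ^ (2*n+1))\<close> then
  give the series at \<open>m+1\<close> and \<open>m+2\<close>.\<close>

lemma gg_series_rec:
  assumes q: "norm q < 1"
  shows "gg_series q m = (1 + q ^ (2*m+1)) * gg_series q (m+1) + q ^ (2*m+2) * gg_series q (m+2)"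
proof -
  define c where "c = gg_coeff q"
  note sm = gg_series_summable[OF q, folded c_def]
  define d where "d = (\<lambda>n. c n * (q ^ (2 * m)) ^ n - c n * (q ^ (2 * (m+1))) ^ n)"
  have d_eq: "d n = c n * (1 - (q\<^sup>2) ^ n) * (q ^ (2 * m)) ^ n" for n
    by (simp add: d_def algebra_simps power_add power_mult_distrib power2_eq_square)
  have "d (Suc n) = q ^ (2*m+1) * (c n * (q ^ (2*(m+1))) ^ n) + q ^ (2*m+2) * (c n * (q ^ (2*(m+2))) ^ n)" for n
  proof -
    have "d (Suc n) = q ^ (2*n+1) * (1 + q ^ (2*n+1)) * c n * (q ^ (2 * m)) ^ Suc n"
      unfolding d_eq using gg_coeff_Suc[OF q, of n] by (simp only: c_def)
    also have "\<dots> = c n * q ^ (2*n+1 + 2*m*Suc n) + c n * q ^ (2*n+1 + (2*n+1) + 2*m*Suc n)"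
      by (simp only: power_add power_mult[symmetric] distrib_left distrib_right mult_1_right mult_1_left mult_ac)
    also have "\<dots> = c n * q ^ (2*m+1 + 2*(m+1)*n) + c n * q ^ (2*m+2 + 2*(m+2)*n)"
    proof -
      have "2*n+1 + 2*m*Suc n = 2*m+1 + 2*(m+1)*n" "2*n+1 + (2*n+1) + 2*m*Suc n = 2*m+2 + 2*(m+2)*n"
        by (simp_all add: algebra_simps)
      then show ?thesis by (simp only:)
    qed
    also have "\<dots> = q ^ (2*m+1) * (c n * (q ^ (2*(m+1))) ^ n) + q ^ (2*m+2) * (c n * (q ^ (2*(m+2))) ^ n)"
      by (simp only: power_add power_mult[symmetric] mult_ac)
    finally show ?thesis .
  qed
  moreover have "(\<lambda>n. q ^ (2*m+1) * (c n * (q ^ (2*(m+1))) ^ n) + q ^ (2*m+2) * (c n * (q ^ (2*(m+2))) ^ n))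
      sums (q ^ (2*m+1) * gg_series q (m+1) + q ^ (2*m+2) * gg_series q (m+2))"
    unfolding gg_series_def c_def[symmetric] by (intro sums_add sums_mult summable_sums sm)
  ultimately have "(\<lambda>n. d (Suc n)) sums (q ^ (2*m+1) * gg_series q (m+1) + q ^ (2*m+2) * gg_series q (m+2))"
    by simp
  \<comment> \<open>The index shift costs nothing because \<open>d 0 = 0\<close>.\<close>
  then have "d sums (q ^ (2*m+1) * gg_series q (m+1) + q ^ (2*m+2) * gg_series q (m+2))"
    by (subst (asm) sums_Suc_iff) (simp add: d_def)
  moreover have "d sums (gg_series q m - gg_series q (m+1))"
    unfolding d_def gg_series_def c_def[symmetric] by (intro sums_diff summable_sums sm)
  ultimately have "gg_series q m - gg_series q (m+1) =
      q ^ (2*m+1) * gg_series q (m+1) + q ^ (2*m+2) * gg_series q (m+2)"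
    by (rule sums_unique2[symmetric])
  then show ?thesis
    by (simp only: algebra_simps mult_1_left)
qed

lemma power_mult_LIMSEQ_zero:
  fixes q :: complex
  assumes "norm q < 1" "k > 0"
  shows "(\<lambda>m. q ^ (k * m)) \<longlonglongrightarrow> 0"
  unfolding power_mult using assms by (intro LIMSEQ_power_zero) (simp add: norm_power power_less_one_iff)

text \<open>A power series summable at 1 is continuous at 0, so the limit is the coefficient for
  \<open>n = 0\<close>.\<close>

lemma gg_series_LIMSEQ:
  assumes q: "norm q < 1"
  shows "gg_series q \<longlonglongrightarrow> 1"
proof -
  have "isCont (\<lambda>z. \<Sum>n. gg_coeff q n * z ^ n) 0"
  proof (rule isCont_powser)
    show "summable (\<lambda>n. gg_coeff q n * 1 ^ n)"
      using summable_norm_cancel[OF gg_coeff_summable[OF q]] by simp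
  qed simp
  then have "(\<lambda>m. \<Sum>n. gg_coeff q n * (q ^ (2 * m)) ^ n) \<longlonglongrightarrow> (\<Sum>n. gg_coeff q n * 0 ^ n)"
    by (rule isCont_tendsto_compose) (intro power_mult_LIMSEQ_zero q, simp)
  moreover have "(\<Sum>n. gg_coeff q n * 0 ^ n) = 1"
    unfolding powser_zero by (simp add: gg_coeff_def)
  ultimately show ?thesis
    by (simp add: gg_series_def[abs_def])
qed

subsection \<open>The partition generating functions\<close>

definition G_rel :: "nat \<Rightarrow> nat \<Rightarrow> bool" where
  "G_rel a b \<longleftrightarrow> a \<ge> b + 2 \<and> (even a \<and> even b \<longrightarrow> a \<ge> b + 4)"

text \<open>\<open>G_rel\<close> is transitive, since two successive gaps of at least 2 already make
  a gap of 4. Passing from neighbours to all pairs makes it easy to append a last part.\<close>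

lemma G_partition_iff: "G_partition xs \<longleftrightarrow> (\<forall>x\<in>set xs. x > 0) \<and> sorted_wrt G_rel xs"
proof -
  have "transp G_rel" by (auto simp: transp_def G_rel_def)
  then show ?thesis
    unfolding G_partition_def G_rel_def[abs_def, symmetric] by (simp add: successively_conv_sorted_wrt)
qed

lemma G_partition_sorted: "G_partition xs \<Longrightarrow> sorted_wrt (>) xs"
  unfolding G_partition_iff by (auto intro: sorted_wrt_mono_rel[of _ G_rel] simp: G_rel_def)

definition G_above :: "nat \<Rightarrow> nat list set" where
  "G_above m = {xs. G_partition xs \<and> (\<forall>x\<in>set xs. x > 2 * m)}"

lemma G_above_0: "G_above 0 = {xs. G_partition xs}"
  by (auto simp: G_above_def G_partition_def)

text \<open>The lists decrease, so the last entry is the smallest part. The three sets correspond to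
  its being absent or above \<open>2*m+2\<close>, equal to \<open>2*m+1\<close>, or equal to
  \<open>2*m+2\<close>.\<close>

lemma G_above_decomp:
  "G_above m = G_above (m+1) \<union> ((\<lambda>ys. ys @ [2*m+1]) ` G_above (m+1) \<union> (\<lambda>ys. ys @ [2*m+2]) ` G_above (m+2))"
  (is "_ = ?R")
proof (intro equalityI subsetI)
  fix xs assume xs: "xs \<in> G_above m"
  show "xs \<in> ?R"
  proof (cases xs rule: rev_cases)
    case Nil
    then show ?thesis by (simp add: G_above_def G_partition_def)
  next
    case (snoc ys x)
    have ys: "G_partition ys" and rel: "\<And>y. y \<in> set ys \<Longrightarrow> G_rel y x" and x: "x > 2 * m"
      using xs by (auto simp: snoc G_above_def G_partition_iff sorted_wrt_append)
    consider "x = 2*m+1" | "x = 2*m+2" | "x > 2*(m+1)"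
      using x by fastforce
    then show ?thesis
    proof cases
      case 1
      then have "ys \<in> G_above (m+1)"
        using ys rel by (fastforce simp: G_above_def G_rel_def)
      then show ?thesis using 1 snoc by auto
    next
      case 2
      \<comment> \<open>The gap 2 alone would admit \<open>2*m+4\<close>, but this is even and would
        need gap 4; so the other parts exceed \<open>2*(m+2)\<close>.\<close>
      have "y > 2 * (m+2)" if "y \<in> set ys" for y
      proof -
        have "y \<ge> 2*m+4" "even y \<Longrightarrow> y \<ge> 2*m+6"
          using rel[OF that] 2 by (auto simp: G_rel_def)
        moreover have "odd y \<Longrightarrow> y \<noteq> 2*m+4" by auto
        ultimately show ?thesis by (cases "even y") auto
      qed
      then have "ys \<in> G_above (m+2)"
        using ys by (auto simp: G_above_def)
      then show ?thesis using 2 snoc by auto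
    next
      case 3
      have "\<forall>y\<in>set xs. y > 2*(m+1)"
        using 3 rel by (force simp: snoc G_rel_def)
      then have "xs \<in> G_above (m+1)"
        using xs by (auto simp: G_above_def)
      then show ?thesis by auto
    qed
  qed
next
  fix xs assume "xs \<in> ?R"
  then consider "xs \<in> G_above (m+1)" | ys where "xs = ys @ [2*m+1]" "ys \<in> G_above (m+1)"
    | ys where "xs = ys @ [2*m+2]" "ys \<in> G_above (m+2)" by auto
  then show "xs \<in> G_above m"
  proof cases
    case 1
    then show ?thesis by (fastforce simp: G_above_def)
  next
    case (2 ys)
    then have above: "\<And>y. y \<in> set ys \<Longrightarrow> y > 2 * (m+1)"
      by (simp add: G_above_def)
    then have "G_rel y (2*m+1) \<and> y > 2*m" if "y \<in> set ys" for y
      using above[OF that] by (simp add: G_rel_def)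
    then show ?thesis
      using 2 by (simp add: G_above_def G_partition_iff sorted_wrt_append)
  next
    case (3 ys)
    then have above: "\<And>y. y \<in> set ys \<Longrightarrow> y > 2 * (m+2)"
      by (simp add: G_above_def)
    have "G_rel y (2*m+2) \<and> y > 2*m" if "y \<in> set ys" for y
    proof -
      have "y \<noteq> 2 * m + 5" if "even y" using that by auto
      then show ?thesis using above[OF that] by (auto simp: G_rel_def)
    qed
    then show ?thesis
      using 3 by (simp add: G_above_def G_partition_iff sorted_wrt_append)
  qed
qed

section \<open>Convergence of the partition sums\<close>

text \<open>Parts are distinct, so a list may be replaced by its set of parts. A finite sum is then
  at most the sum over all subsets of \<open>S\<close>, that is the product of the
  \<open>r ^ k + 1\<close>, which is at most \<open>exp\<close> of the geometric series.\<close>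

lemma G_partition_summable_real:
  fixes r :: real
  assumes r: "0 \<le> r" "r < 1"
  shows "(\<lambda>xs. r ^ sum_list xs) summable_on {xs. G_partition xs}"
proof (rule nonneg_bdd_above_summable_on)
  show "bdd_above (sum (\<lambda>xs. r ^ sum_list xs) ` {F. F \<subseteq> {xs. G_partition xs} \<and> finite F})"
  proof (rule bdd_aboveI2)
    fix F assume "F \<in> {F. F \<subseteq> {xs. G_partition xs} \<and> finite F}"
    then have F: "finite F" "\<And>xs. xs \<in> F \<Longrightarrow> G_partition xs" by auto
    define S where "S = (\<Union>xs\<in>F. set xs)"
    have S: "finite S" using F by (simp add: S_def)
    have sorted: "sorted_wrt (>) xs" if "xs \<in> F" for xs
      using G_partition_sorted F(2)[OF that] .
    have "sorted_wrt (<) (rev xs)" if "xs \<in> F" for xs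
      using sorted[OF that] by (simp add: sorted_wrt_rev)
    then have inj: "inj_on set F"
      by (intro inj_onI) (metis rev_rev_ident set_rev strict_sorted_equal)
    have "(\<Sum>xs\<in>F. r ^ sum_list xs) = (\<Sum>xs\<in>F. \<Prod>k\<in>set xs. r ^ k)"
    proof (rule sum.cong[OF refl])
      fix xs assume "xs \<in> F"
      then have "distinct xs"
        using sorted by (metis distinct_rev sorted_wrt_rev strict_sorted_iff)
      then show "r ^ sum_list xs = (\<Prod>k\<in>set xs. r ^ k)"
        by (simp add: power_sum sum_list_distinct_conv_sum_set[where f = "\<lambda>x. x", simplified])
    qed
    also have "\<dots> = (\<Sum>A\<in>set ` F. \<Prod>k\<in>A. r ^ k)"
      by (simp add: sum.reindex[OF inj])
    also have "\<dots> \<le> (\<Sum>A\<in>Pow S. \<Prod>k\<in>A. r ^ k)"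
      using S r by (intro sum_mono2) (auto simp: S_def intro!: prod_nonneg)
    also have "\<dots> = (\<Prod>k\<in>S. r ^ k + 1)"
      using S by (subst prod_add) auto
    also have "\<dots> \<le> (\<Prod>k\<in>S. exp (r ^ k))"
      using r by (intro prod_mono) (auto simp: add.commute exp_ge_add_one_self)
    also have "\<dots> = exp (\<Sum>k\<in>S. r ^ k)"
      using S by (simp add: exp_sum)
    also have "(\<Sum>k\<in>S. r ^ k) \<le> (\<Sum>k. r ^ k)"
      using S r by (intro sum_le_suminf) auto
    finally show "(\<Sum>xs\<in>F. r ^ sum_list xs) \<le> exp (\<Sum>k. r ^ k)"
      by simp
  qed
qed (use r in auto)

lemma G_partition_norm_summable:
  assumes "norm (q :: complex) < 1"
  shows "(\<lambda>xs. norm (q ^ sum_list xs)) summable_on {xs. G_partition xs}"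
  using G_partition_summable_real[of "norm q"] assms by (simp add: norm_power)

lemma G_above_summable:
  assumes "norm (q :: complex) < 1"
  shows "(\<lambda>xs. q ^ sum_list xs) summable_on G_above m"
  by (rule summable_on_subset_banach[OF abs_summable_summable[OF G_partition_norm_summable[OF assms]]])
     (auto simp: G_above_def)

definition G_gf :: "complex \<Rightarrow> nat \<Rightarrow> complex" where
  "G_gf q m = (\<Sum>\<^sub>\<infinity>xs\<in>G_above m. q ^ sum_list xs)"

lemma G_gf_has_sum:
  assumes "norm q < 1"
  shows "((\<lambda>xs. q ^ sum_list xs) has_sum G_gf q m) (G_above m)"
  unfolding G_gf_def using G_above_summable[OF assms] by (rule has_sum_infsum)

lemma G_gf_rec:
  assumes q: "norm q < 1"
  shows "G_gf q m = (1 + q ^ (2*m+1)) * G_gf q (m+1) + q ^ (2*m+2) * G_gf q (m+2)"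
proof -
  let ?f = "\<lambda>xs. q ^ sum_list xs"
  have snoc: "(?f has_sum (q ^ x * G_gf q k)) ((\<lambda>ys. ys @ [x]) ` G_above k)" for x k
  proof (subst has_sum_reindex)
    show "((?f \<circ> (\<lambda>ys. ys @ [x])) has_sum q ^ x * G_gf q k) (G_above k)"
      using has_sum_cmult_right[OF G_gf_has_sum[OF q], of "q ^ x"]
      by (simp add: o_def power_add mult.commute)
  qed (auto simp: inj_on_def)
  have "(?f has_sum (G_gf q (m+1) + (q ^ (2*m+1) * G_gf q (m+1) + q ^ (2*m+2) * G_gf q (m+2)))) (G_above m)"
    unfolding G_above_decomp[of m]
    by (intro has_sum_Un_disjoint snoc G_gf_has_sum[OF q]) (auto simp: G_above_def)
  from has_sum_unique[OF G_gf_has_sum[OF q] this] show ?thesis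
    by (simp add: algebra_simps)
qed

text \<open>The empty partition contributes 1; every other list in \<open>G_above m\<close> contains
  a part exceeding \<open>2 * m\<close>, so the rest dies out.\<close>

lemma G_gf_LIMSEQ:
  assumes q: "norm q < 1"
  shows "G_gf q \<longlonglongrightarrow> 1"
proof -
  \<comment> \<open>One factor \<open>s\<^bsup>|\<pi>|\<^esup>\<close> of \<open>|q|\<^bsup>|\<pi>|\<^esup>\<close> gives the decay in \<open>m\<close>, the other one summability.\<close>
  define s where "s = sqrt (norm q)"
  have s: "0 \<le> s" "s < 1" "s * s = norm q" using q by (auto simp: s_def)
  define K where "K = (\<Sum>\<^sub>\<infinity>xs\<in>{xs. G_partition xs}. s ^ sum_list xs)"
  have bound: "norm (G_gf q m - 1) \<le> K * s ^ m" for m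
  proof -
    let ?B = "G_above m - {[]}"
    have sub: "?B \<subseteq> {xs. G_partition xs}" by (auto simp: G_above_def)
    have nil: "[] \<in> G_above m" by (simp add: G_above_def G_partition_def)
    have "((\<lambda>xs. q ^ sum_list xs) has_sum (G_gf q m - q ^ sum_list [])) ?B"
      using has_sum_Diff[OF G_gf_has_sum[OF q, of m], of "{[]}" "q ^ sum_list []"] nil
        has_sum_finite[of "{[]}" "\<lambda>xs. q ^ sum_list xs"] by auto
    then have "norm (G_gf q m - 1) = norm (\<Sum>\<^sub>\<infinity>xs\<in>?B. q ^ sum_list xs)"
      by (auto dest!: infsumI)
    also have "\<dots> \<le> (\<Sum>\<^sub>\<infinity>xs\<in>?B. norm (q ^ sum_list xs))"
      by (intro norm_infsum_bound summable_on_subset_banach[OF G_partition_norm_summable[OF q] sub])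
    also have "\<dots> \<le> (\<Sum>\<^sub>\<infinity>xs\<in>?B. s ^ m * s ^ sum_list xs)"
    proof (rule infsum_mono)
      show "(\<lambda>xs. norm (q ^ sum_list xs)) summable_on ?B"
        by (rule summable_on_subset_banach[OF G_partition_norm_summable[OF q] sub])
      show "(\<lambda>xs. s ^ m * s ^ sum_list xs) summable_on ?B"
        by (intro summable_on_cmult_right summable_on_subset_banach[OF G_partition_summable_real[OF s(1,2)] sub])
      fix xs assume xs: "xs \<in> ?B"
      then obtain x where "x \<in> set xs" "x > 2 * m"
        by (cases xs) (auto simp: G_above_def)
      then have "sum_list xs \<ge> m"
        using member_le_sum_list[of x xs] by simp
      then have "s ^ sum_list xs \<le> s ^ m"
        using s by (intro power_decreasing) auto
      then have "s ^ sum_list xs * s ^ sum_list xs \<le> s ^ m * s ^ sum_list xs"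
        using s by (intro mult_right_mono) auto
      then show "norm (q ^ sum_list xs) \<le> s ^ m * s ^ sum_list xs"
        by (simp add: norm_power s(3)[symmetric] power_mult_distrib)
    qed
    also have "\<dots> \<le> (\<Sum>\<^sub>\<infinity>xs\<in>{xs. G_partition xs}. s ^ m * s ^ sum_list xs)"
      using s sub
      by (intro infsum_mono2 summable_on_cmult_right G_partition_summable_real
            summable_on_subset_banach[OF G_partition_summable_real[OF s(1,2)] sub]) auto
    also have "\<dots> = K * s ^ m"
      unfolding K_def using G_partition_summable_real[OF s(1,2)] by (subst infsum_cmult_right) auto
    finally show ?thesis .
  qed
  have "(\<lambda>m. K * s ^ m) \<longlonglongrightarrow> 0"
    using s by (intro tendsto_mult_right_zero LIMSEQ_power_zero) auto
  then have "(\<lambda>m. G_gf q m - 1) \<longlonglongrightarrow> 0"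
    by (rule Lim_null_comparison[rotated]) (simp add: bound)
  then show ?thesis by (simp add: LIM_zero_iff)
qed

subsection \<open>The very-well-poised series\<close>

text \<open>At \<open>m = 0\<close> the Pochhammer quotients collapse to
  \<open>1 / (1 + q ^ (2*n+1))\<close>. The subtraction in \<open>4 * n\<^sup>2 - n\<close> never
  truncates.\<close>

definition gg_weight :: "complex \<Rightarrow> nat \<Rightarrow> nat \<Rightarrow> complex" where
  "gg_weight q m n = (-1) ^ n * q ^ (4 * n\<^sup>2 - n) * (q ^ (2 * m)) ^ (2 * n)
     * qpoch (q\<^sup>2) (q\<^sup>2) (m + n) * qpoch (-q) (q\<^sup>2) n
     / (qpoch (q\<^sup>2) (q\<^sup>2) n * qpoch (-q) (q\<^sup>2) (Suc (m + n)))"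

text \<open>The very-well-poised series behind the product side, at \<open>x = q\<^bsup>2m\<^esup>\<close>. Its terms
  are regrouped so that the factor \<open>1 / (1 - x)\<close>, singular at \<open>m = 0\<close>, never appears.\<close>

definition gg_term :: "complex \<Rightarrow> nat \<Rightarrow> nat \<Rightarrow> complex" where
  "gg_term q m n = gg_weight q m n *
     (1 + q * q ^ (2*m) * q ^ (2*n) - q ^ 5 * (q ^ (2*m)) ^ 3 * (q ^ (2*n)) ^ 5 * (1 + q * q ^ (2*n)))"

text \<open>The polynomial factor is determined, coefficient by coefficient in \<open>y\<close>, by the ansatz
  \<open>gg_cert = gg_weight \<cdot> (1 - y) P(y) / (1 + q\<^sup>3xy)\<close> for the identity \<open>gg_term_telescope\<close>.\<close>

definition gg_cert :: "complex \<Rightarrow> nat \<Rightarrow> nat \<Rightarrow> complex" where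
  "gg_cert q m n = (let x = q ^ (2*m); y = q ^ (2*n) in
     - gg_weight q m n * (1 - y) / (1 + q ^ 3 * x * y) *
     (1 + q*x*y + q^3*x*y + y + q^4*x^2*y^2 + q^3*x*y^2 + q^2*x*y^3 + q^3*x^2*y^3
      + q^5*x^2*y^4 + q^6*x^3*y^4 + q^6*x^2*y^5 - q^8*x^3*y^6))"

section \<open>Verification of the telescoping certificate\<close>

lemma one_plus_power_Suc_nonzero:
  fixes q :: complex
  assumes "norm q < 1"
  shows "1 + q ^ Suc k \<noteq> 0" "1 - q ^ Suc k \<noteq> 0"
proof -
  have "norm (q ^ Suc k) < 1"
    unfolding norm_power using assms power_less_one_iff[of "norm q" "Suc k"] by simp
  then show "1 + q ^ Suc k \<noteq> 0" "1 - q ^ Suc k \<noteq> 0"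
    by (metis add_eq_0_iff less_irrefl norm_minus_cancel norm_one)
       (metis \<open>norm (q ^ Suc k) < 1\<close> eq_iff_diff_eq_0 less_irrefl norm_one)
qed

text \<open>With \<open>gg_weight_Suc_right\<close>, this makes every weight in the telescoping
  relation a multiple of \<open>gg_weight q m n\<close> by a rational function of \<open>q\<close>,
  \<open>q ^ (2*m)\<close> and \<open>q ^ (2*n)\<close>.\<close>

lemma gg_weight_Suc_left:
  "gg_weight q (Suc m) n = gg_weight q m n * (q ^ (2*n)) ^ 2
    * (1 - q\<^sup>2 * q ^ (2*m) * q ^ (2*n)) / (1 + q ^ 3 * q ^ (2*m) * q ^ (2*n))"
proof -
  have pw: "(q\<^sup>2) ^ k = q ^ (2 * k)" for k
    by (simp add: power_mult)
  have e: "q\<^sup>2 * (q\<^sup>2) ^ (m + n) = q\<^sup>2 * q ^ (2*m) * q ^ (2*n)"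
     "- q * (q\<^sup>2) ^ Suc (m + n) = - (q ^ 3 * q ^ (2*m) * q ^ (2*n))"
    unfolding pw by (simp_all add: distrib_left power_add power2_eq_square power3_eq_cube mult_ac)
  have e': "(q ^ (2 * Suc m)) ^ (2 * n) = (q ^ (2*m)) ^ (2 * n) * (q ^ (2*n)) ^ 2"
    unfolding power_mult[symmetric] power_add[symmetric]
    by (intro arg_cong2[where f = "(^)"] refl) (simp add: algebra_simps)
  show ?thesis
    unfolding gg_weight_def add_Suc qpoch_Suc[of "q\<^sup>2" _ "m + n"] qpoch_Suc[of "-q" _ "Suc (m + n)"] e e'
    by (simp add: mult_ac)
qed

lemma gg_weight_Suc_right:
  "gg_weight q m (Suc n) = - gg_weight q m n * q ^ 3 * (q ^ (2*m)) ^ 2 * (q ^ (2*n)) ^ 4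
    * (1 - q\<^sup>2 * q ^ (2*m) * q ^ (2*n)) * (1 + q * q ^ (2*n))
    / ((1 - q\<^sup>2 * q ^ (2*n)) * (1 + q ^ 3 * q ^ (2*m) * q ^ (2*n)))"
proof -
  have "n \<le> 4 * n\<^sup>2" by (cases n) (auto simp: power2_eq_square)
  then have ex: "4 * (Suc n)\<^sup>2 - Suc n = (4 * n\<^sup>2 - n) + (3 + 2 * n * 4)"
    by (simp add: power2_eq_square)
  have pw: "(q\<^sup>2) ^ k = q ^ (2 * k)" for k
    by (simp add: power_mult)
  have e: "q\<^sup>2 * (q\<^sup>2) ^ (m + n) = q\<^sup>2 * q ^ (2*m) * q ^ (2*n)"
     "- q * (q\<^sup>2) ^ Suc (m + n) = - (q ^ 3 * q ^ (2*m) * q ^ (2*n))"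
     "q\<^sup>2 * (q\<^sup>2) ^ n = q\<^sup>2 * q ^ (2*n)" "- q * (q\<^sup>2) ^ n = - (q * q ^ (2*n))"
     "(q ^ (2 * m)) ^ (2 * Suc n) = (q ^ (2*m)) ^ (2 * n) * (q ^ (2*m)) ^ 2"
    unfolding pw by (simp_all add: distrib_left power_add power2_eq_square power3_eq_cube mult_ac)
  have e': "q ^ (4 * (Suc n)\<^sup>2 - Suc n) = q ^ (4 * n\<^sup>2 - n) * (q ^ 3 * (q ^ (2*n)) ^ 4)"
    unfolding ex by (simp only: power_add power_mult)
  show ?thesis
    unfolding gg_weight_def add_Suc_right qpoch_Suc[of "q\<^sup>2" _ "m + n"] qpoch_Suc[of "-q" _ "Suc (m + n)"]
      qpoch_Suc[of _ _ n] e e'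
    by (simp add: mult_ac)
qed

text \<open>The telescoping relation divided by \<open>gg_weight q m n\<close>, with
  \<open>x\<close> for \<open>q ^ (2*m)\<close> and \<open>y\<close> for \<open>q ^ (2*n)\<close>.
  The first summand on the right comes from the certificate at \<open>Suc n\<close>, where
  \<open>y\<close> becomes \<open>q^2*y\<close>; the second is minus the one at
  \<open>n\<close>.\<close>

lemma gg_certificate_identity:
  fixes q x y :: complex
  assumes "1 + q ^ 3 * x * y \<noteq> 0" "1 + q ^ 5 * x * y \<noteq> 0"
  shows "(1 + q*x*y - q^5*x^3*y^5*(1 + q*y))
     - (1 + q*x) * (y^2 * (1 - q^2*x*y) / (1 + q^3*x*y)) * (1 + q^3*x*y - q^11*x^3*y^5*(1 + q*y))
     - q^2*x * (y^2 * (1 - q^2*x*y) / (1 + q^3*x*y) * (y^2 * (1 - q^4*x*y) / (1 + q^5*x*y)))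
         * (1 + q^5*x*y - q^17*x^3*y^5*(1 + q*y))
   = q^3*x^2*y^4 * (1 - q^2*x*y) * (1 + q*y) / (1 + q^3*x*y) / (1 + q^5*x*y) *
       (1 + q^3*x*y + q^5*x*y + q^2*y + q^8*x^2*y^2 + q^7*x*y^2 + q^8*x*y^3 + q^9*x^2*y^3
      + q^13*x^2*y^4 + q^14*x^3*y^4 + q^16*x^2*y^5 - q^20*x^3*y^6)
     + (1 - y) / (1 + q^3*x*y) *
       (1 + q*x*y + q^3*x*y + y + q^4*x^2*y^2 + q^3*x*y^2 + q^2*x*y^3 + q^3*x^2*y^3
      + q^5*x^2*y^4 + q^6*x^3*y^4 + q^6*x^2*y^5 - q^8*x^3*y^6)"
  (is "?A - ?B * (?y2 / ?d) * ?C - ?D * (?y2 / ?d * (?y3 / ?e)) * ?F = ?G / ?d / ?e * ?H + ?I / ?d * ?J")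
proof -
  have "?A * ?d * ?e - ?B * ?y2 * ?C * ?e - ?D * ?y2 * ?y3 * ?F = ?G * ?H + ?I * ?J * ?e"
    by algebra
  \<comment> \<open>Abstract letters keep the polynomials unexpanded while denominators are
    cleared.\<close>
  moreover have "A - B * (u / d) * C - D * (u / d * (v / e)) * F = G / d / e * H + I / d * J"
    if "A * d * e - B * u * C * e - D * u * v * F = G * H + I * J * e" "d \<noteq> 0" "e \<noteq> 0"
    for A B C D F G H I J d e u v :: complex
    using that by (simp add: field_simps)
  ultimately show ?thesis
    using assms by blast
qed

lemma gg_term_telescope:
  assumes q: "norm q < 1"
  shows "gg_term q m n - (1 + q ^ (2*m+1)) * gg_term q (m+1) n - q ^ (2*m+2) * gg_term q (m+2) n
    = gg_cert q m (Suc n) - gg_cert q m n"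
proof -
  define x y where "x = q ^ (2*m)" and "y = q ^ (2*n)"
  define W where "W = gg_weight q m n"
  have pows: "q ^ (2 * Suc m) = q\<^sup>2 * x" "q ^ (2 * Suc (Suc m)) = q ^ 4 * x" "q ^ (2 * Suc n) = q\<^sup>2 * y"
    "q ^ (2*m+1) = q * x" "q ^ (2*m+2) = q\<^sup>2 * x"
    by (simp_all add: x_def y_def power_add eval_nat_numeral)
  have "q ^ 3 * x * y = q ^ Suc (2 + 2*m + 2*n)" "q ^ 5 * x * y = q ^ Suc (4 + 2*m + 2*n)"
    "q\<^sup>2 * y = q ^ Suc (1 + 2*n)"
    by (simp_all add: x_def y_def power_add eval_nat_numeral)
  then have nz: "1 + q ^ 3 * x * y \<noteq> 0" "1 + q ^ 5 * x * y \<noteq> 0" "1 - q\<^sup>2 * y \<noteq> 0"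
    by (simp_all only: one_plus_power_Suc_nonzero[OF q] not_False_eq_True)
  define a b where "a = y\<^sup>2 * (1 - q\<^sup>2 * x * y) / (1 + q ^ 3 * x * y)"
    and "b = y\<^sup>2 * (1 - q ^ 4 * x * y) / (1 + q ^ 5 * x * y)"
  have W1: "gg_weight q (Suc m) n = W * a"
    unfolding gg_weight_Suc_left W_def x_def[symmetric] y_def[symmetric] a_def by simp
  have W2: "gg_weight q (Suc (Suc m)) n = W * (a * b)"
    unfolding gg_weight_Suc_left[of q "Suc m"] W1 pows y_def[symmetric] b_def
    by (simp add: eval_nat_numeral mult_ac)
  \<comment> \<open>The factor \<open>1 - q\<^sup>2 * y\<close> of the certificate at
    \<open>Suc n\<close> cancels a denominator of the weight ratio, so the two are treated
    together.\<close>
  have W3: "gg_weight q m (Suc n) * (1 - q\<^sup>2 * y) =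
      - (W * (q ^ 3 * x\<^sup>2 * y ^ 4 * (1 - q\<^sup>2 * x * y) * (1 + q * y) / (1 + q ^ 3 * x * y)))"
    unfolding gg_weight_Suc_right W_def[symmetric] x_def[symmetric] y_def[symmetric]
    using nz(3) by (simp add: mult_ac)
  have T0: "gg_term q m n = W * (1 + q*x*y - q^5*x^3*y^5*(1 + q*y))"
    by (simp only: gg_term_def W_def x_def y_def)
  have T1: "gg_term q (m+1) n = W * a * (1 + q^3*x*y - q^11*x^3*y^5*(1 + q*y))"
    unfolding gg_term_def Suc_eq_plus1[symmetric] W1 pows y_def[symmetric]
    by (simp add: power_mult_distrib eval_nat_numeral mult_ac)
  have T2: "gg_term q (m+2) n = W * (a * b) * (1 + q^5*x*y - q^17*x^3*y^5*(1 + q*y))"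
    unfolding gg_term_def add_2_eq_Suc' W2 pows y_def[symmetric]
    by (simp add: power_mult_distrib eval_nat_numeral mult_ac)
  have C0: "gg_cert q m n = - W * ((1 - y) / (1 + q^3*x*y) *
       (1 + q*x*y + q^3*x*y + y + q^4*x^2*y^2 + q^3*x*y^2 + q^2*x*y^3 + q^3*x^2*y^3
      + q^5*x^2*y^4 + q^6*x^3*y^4 + q^6*x^2*y^5 - q^8*x^3*y^6))"
    unfolding gg_cert_def Let_def W_def[symmetric] x_def[symmetric] y_def[symmetric] by simp
  have "gg_cert q m (Suc n) = - (gg_weight q m (Suc n) * (1 - q\<^sup>2 * y)) / (1 + q^5*x*y) *
       (1 + q^3*x*y + q^5*x*y + q^2*y + q^8*x^2*y^2 + q^7*x*y^2 + q^8*x*y^3 + q^9*x^2*y^3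
      + q^13*x^2*y^4 + q^14*x^3*y^4 + q^16*x^2*y^5 - q^20*x^3*y^6)"
    unfolding gg_cert_def Let_def x_def[symmetric] pows
    by (simp add: power_mult_distrib eval_nat_numeral mult_ac)
  then have C1: "gg_cert q m (Suc n) = W * (q^3*x^2*y^4 * (1 - q^2*x*y) * (1 + q*y) / (1 + q^3*x*y) / (1 + q^5*x*y) *
       (1 + q^3*x*y + q^5*x*y + q^2*y + q^8*x^2*y^2 + q^7*x*y^2 + q^8*x*y^3 + q^9*x^2*y^3
      + q^13*x^2*y^4 + q^14*x^3*y^4 + q^16*x^2*y^5 - q^20*x^3*y^6))"
    unfolding W3 by simp
  note id = gg_certificate_identity[OF nz(1,2), folded a_def b_def]
  have "gg_term q m n - (1 + q ^ (2*m+1)) * gg_term q (m+1) n - q ^ (2*m+2) * gg_term q (m+2) n =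
     W * ((1 + q*x*y - q^5*x^3*y^5*(1 + q*y)) - (1 + q*x) * a * (1 + q^3*x*y - q^11*x^3*y^5*(1 + q*y))
     - q^2*x * (a * b) * (1 + q^5*x*y - q^17*x^3*y^5*(1 + q*y)))"
    unfolding T0 T1 T2 pows by (simp only: right_diff_distrib[of W] mult_ac)
  also note id
  finally show ?thesis
    unfolding C0 C1 by (simp only: distrib_left[of W] minus_mult_left[symmetric] diff_minus_eq_add)
qed

section \<open>Bounds, summability and limit of the very-well-poised series\<close>

text \<open>Uniformity in \<open>m\<close> is the point: one bound serves both summability in
  \<open>n\<close> and domination as \<open>m\<close> grows. The Pochhammer symbols and their
  inverses are bounded, and \<open>n \<le> 4 * n\<^sup>2 - n\<close> gives the decay.\<close>

lemma gg_weight_bound: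
  assumes q: "norm q < 1"
  obtains K where "K > 0" "\<And>m n. norm (gg_weight q m n) \<le> K * norm q ^ n"
proof -
  have q2: "norm (q\<^sup>2) < 1" and mq: "norm (-q) < 1"
    using norm_power2_less_one[OF q] q by auto
  obtain K1 where K1: "K1 > 0" "\<And>n. norm (qpoch (q\<^sup>2) (q\<^sup>2) n) \<le> K1"
    using qpoch_bounded[OF q2] by blast
  obtain K2 where K2: "K2 > 0" "\<And>n. norm (qpoch (-q) (q\<^sup>2) n) \<le> K2"
    using qpoch_bounded[OF q2] by blast
  obtain K3 where K3: "K3 > 0" "\<And>n. norm (inverse (qpoch (q\<^sup>2) (q\<^sup>2) n)) \<le> K3"
    using inverse_qpoch_bounded[OF q2 q2] by blast
  obtain K4 where K4: "K4 > 0" "\<And>n. norm (inverse (qpoch (-q) (q\<^sup>2) n)) \<le> K4"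
    using inverse_qpoch_bounded[OF q2 mq] by blast
  show thesis
  proof
    show "K1 * K2 * (K3 * K4) > 0" using K1 K2 K3 K4 by simp
    fix m n :: nat
    have "n \<le> 4 * n\<^sup>2 - n" by (cases n) (auto simp: power2_eq_square)
    moreover have "norm q ^ (2 * m) \<le> 1" using q by (intro power_le_one) auto
    ultimately have "norm (gg_weight q m n) \<le> 1 * norm q ^ n * 1 * K1 * K2 * (K3 * K4)"
      unfolding gg_weight_def divide_inverse inverse_mult_distrib norm_mult norm_power
      using q K1 K2 K3 K4
      by (intro mult_mono power_decreasing power_le_one mult_nonneg_nonneg) auto
    then show "norm (gg_weight q m n) \<le> K1 * K2 * (K3 * K4) * norm q ^ n"
      by (simp add: mult_ac)
  qed
qed

lemma gg_term_bound:
  assumes q: "norm q < 1"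
  obtains K where "K > 0" "\<And>m n. norm (gg_term q m n) \<le> K * norm q ^ n"
proof -
  obtain K where K: "K > 0" "\<And>m n. norm (gg_weight q m n) \<le> K * norm q ^ n"
    using gg_weight_bound[OF q] by blast
  show thesis
  proof
    show "K * 4 > 0" using K by simp
    fix m n :: nat
    have le1: "norm (q ^ k) \<le> 1" for k
      using q by (simp add: norm_power power_le_one)
    \<comment> \<open>Expanded, the factor is a signed sum of four monomials of norm at most
      1.\<close>
    have nle: "norm (1 + q ^ (1 + 2*m + 2*n) - (q ^ (5 + 2*m*3 + 2*n*5) + q ^ (6 + 2*m*3 + 2*n*6))) \<le> (1 + 1) + (1 + 1)"
      by (intro norm_triangle_le_diff norm_triangle_le add_mono le1) auto
    have eq: "1 + q * q ^ (2*m) * q ^ (2*n) - q ^ 5 * (q ^ (2*m)) ^ 3 * (q ^ (2*n)) ^ 5 * (1 + q * q ^ (2*n))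
        = 1 + q ^ (1 + 2*m + 2*n) - (q ^ (5 + 2*m*3 + 2*n*5) + q ^ (6 + 2*m*3 + 2*n*6))"
      unfolding power_add power_mult by (simp add: algebra_simps eval_nat_numeral)
    have "norm (gg_term q m n) \<le> K * norm q ^ n * ((1 + 1) + (1 + 1))"
      unfolding gg_term_def norm_mult[of "gg_weight q m n"] eq using K(1)
      by (intro mult_mono K(2) nle) auto
    then show "norm (gg_term q m n) \<le> K * 4 * norm q ^ n"
      by (simp add: mult_ac)
  qed
qed

lemma gg_term_summable:
  assumes q: "norm q < 1"
  shows "summable (gg_term q m)"
proof -
  obtain K where K: "K > 0" "\<And>m n. norm (gg_term q m n) \<le> K * norm q ^ n"
    using gg_term_bound[OF q] by blast
  have "summable (\<lambda>n. K * norm q ^ n)"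
    using q by (intro summable_mult) simp
  then show ?thesis
    by (rule summable_comparison_test') (rule K(2))
qed

lemma gg_cert_LIMSEQ:
  assumes q: "norm q < 1"
  shows "gg_cert q m \<longlonglongrightarrow> 0"
proof -
  obtain K where K: "K > 0" "\<And>m n. norm (gg_weight q m n) \<le> K * norm q ^ n"
    using gg_weight_bound[OF q] by blast
  have "(\<lambda>n. K * norm q ^ n) \<longlonglongrightarrow> 0"
    using q by (intro tendsto_mult_right_zero LIMSEQ_power_zero) auto
  then have W: "gg_weight q m \<longlonglongrightarrow> 0"
    by (rule Lim_null_comparison[rotated]) (simp add: K)
  have y: "(\<lambda>n. q ^ (2 * n)) \<longlonglongrightarrow> 0"
    using q by (intro power_mult_LIMSEQ_zero) auto
  define x where "x = q ^ (2 * m)"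
  have "gg_cert q m \<longlonglongrightarrow> - 0 * (1 - 0) / (1 + q ^ 3 * x * 0) *
     (1 + q*x*0 + q^3*x*0 + 0 + q^4*x^2*0^2 + q^3*x*0^2 + q^2*x*0^3 + q^3*x^2*0^3
      + q^5*x^2*0^4 + q^6*x^3*0^4 + q^6*x^2*0^5 - q^8*x^3*0^6)"
    unfolding gg_cert_def[abs_def] Let_def x_def[symmetric] by (intro tendsto_intros W y) simp
  then show ?thesis by simp
qed

definition gg_sum :: "complex \<Rightarrow> nat \<Rightarrow> complex" where
  "gg_sum q m = (\<Sum>n. gg_term q m n)"

text \<open>Summing \<open>gg_term_telescope\<close> over \<open>n\<close> gives 0: the certificate
  tends to 0, and at \<open>n = 0\<close> its factor \<open>1 - y\<close> vanishes because
  \<open>y = 1\<close>.\<close>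

lemma gg_sum_rec:
  assumes q: "norm q < 1"
  shows "gg_sum q m = (1 + q ^ (2*m+1)) * gg_sum q (m+1) + q ^ (2*m+2) * gg_sum q (m+2)"
proof -
  have "(\<lambda>n. gg_cert q m (Suc n) - gg_cert q m n) sums (0 - gg_cert q m 0)"
    by (intro telescope_sums gg_cert_LIMSEQ q)
  moreover have "gg_cert q m 0 = 0" by (simp add: gg_cert_def)
  moreover have "(\<lambda>n. gg_term q m n - (1 + q ^ (2*m+1)) * gg_term q (m+1) n - q ^ (2*m+2) * gg_term q (m+2) n)
      sums (gg_sum q m - (1 + q ^ (2*m+1)) * gg_sum q (m+1) - q ^ (2*m+2) * gg_sum q (m+2))"
    unfolding gg_sum_def by (intro sums_diff sums_mult summable_sums gg_term_summable q)
  ultimately have "gg_sum q m - (1 + q ^ (2*m+1)) * gg_sum q (m+1) - q ^ (2*m+2) * gg_sum q (m+2) = 0"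
    unfolding gg_term_telescope[OF q] using sums_unique2 by fastforce
  then show ?thesis by (simp add: algebra_simps)
qed

text \<open>Tannery's theorem permits the limit in \<open>m\<close> term by term; the factor
  \<open>(q ^ (2*m)) ^ (2*n)\<close> removes all terms but \<open>n = 0\<close>.\<close>

lemma gg_sum_LIMSEQ:
  assumes q: "norm q < 1"
  shows "gg_sum q \<longlonglongrightarrow> qpoch_inf (q\<^sup>2) (q\<^sup>2) / qpoch_inf (-q) (q\<^sup>2)"
proof -
  have q2: "norm (q\<^sup>2) < 1" and mq: "norm (-q) < 1"
    using norm_power2_less_one[OF q] q by auto
  define L1 where "L1 = qpoch_inf (q\<^sup>2) (q\<^sup>2)"
  define L2 where "L2 = qpoch_inf (-q) (q\<^sup>2)"
  have L2: "L2 \<noteq> 0" using qpoch_inf_nonzero[OF q2 mq] by (simp add: L2_def)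
  obtain K where K: "K > 0" "\<And>m n. norm (gg_term q m n) \<le> K * norm q ^ n"
    using gg_term_bound[OF q] by blast
  have x: "(\<lambda>m. q ^ (2 * m)) \<longlonglongrightarrow> 0"
    using q by (intro power_mult_LIMSEQ_zero) auto
  \<comment> \<open>\<open>0 ^ (2 * n)\<close> is 1 for \<open>n = 0\<close>, so \<open>B\<close> is
    \<open>L1 / L2\<close> there and 0 elsewhere.\<close>
  define B where "B = (\<lambda>n. (-1) ^ n * q ^ (4 * n\<^sup>2 - n) * 0 ^ (2 * n) * L1 * qpoch (-q) (q\<^sup>2) n
     / (qpoch (q\<^sup>2) (q\<^sup>2) n * L2))"
  have lim: "(\<lambda>m. gg_term q m n) \<longlonglongrightarrow> B n" for n
  proof -
    have 1: "(\<lambda>m. qpoch (q\<^sup>2) (q\<^sup>2) (m + n)) \<longlonglongrightarrow> L1"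
      unfolding L1_def by (rule LIMSEQ_ignore_initial_segment[OF qpoch_LIMSEQ[OF q2]])
    have 2: "(\<lambda>m. qpoch (-q) (q\<^sup>2) (Suc (m + n))) \<longlonglongrightarrow> L2"
      unfolding L2_def using LIMSEQ_ignore_initial_segment[OF qpoch_LIMSEQ[OF q2], of "-q" "Suc n"] by simp
    have "qpoch (q\<^sup>2) (q\<^sup>2) n * L2 \<noteq> 0"
      using qpoch_nonzero[OF q2 q2] L2 by simp
    then have W: "(\<lambda>m. gg_weight q m n) \<longlonglongrightarrow> B n"
      unfolding gg_weight_def B_def by (intro tendsto_intros x 1 2)
    have "(\<lambda>m. gg_term q m n) \<longlonglongrightarrow> B n *
        (1 + q * 0 * q ^ (2*n) - q ^ 5 * 0 ^ 3 * (q ^ (2*n)) ^ 5 * (1 + q * q ^ (2*n)))"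
      unfolding gg_term_def by (intro tendsto_intros W x)
    then show ?thesis by simp
  qed
  have "summable (\<lambda>n. K * norm q ^ n)"
    using q by (intro summable_mult) simp
  then have "(\<lambda>m. \<Sum>n. gg_term q m n) \<longlonglongrightarrow> suminf B"
    using tannerys_theorem[of "\<lambda>n m. gg_term q m n" B sequentially "\<lambda>n. K * norm q ^ n"] lim K(2)
    by (auto simp: case_prod_unfold)
  moreover have "suminf B = (\<Sum>n\<in>{0}. B n)"
    by (rule suminf_finite) (auto simp: B_def)
  ultimately show ?thesis
    by (simp add: gg_sum_def[abs_def] B_def L1_def L2_def)
qed

section \<open>Evaluation at \<open>m = 0\<close> as an infinite product\<close>

text \<open>At \<open>m = 0\<close> the polynomial factor is divisible by the denominator
  \<open>1 + q ^ (2*n+1)\<close>, leaving two monomials. Their exponents are the values of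
  \<open>3 * tri j + 5 * tri (j - 1) = 4 * j^2 - j\<close> at \<open>j = n\<close> and
  \<open>j = - n - 1\<close>.\<close>

lemma gg_term_0_eq_theta:
  assumes q: "norm q < 1"
  shows "gg_term q 0 n = theta_term (-(q^3)) (-(q^5)) (int n) + theta_term (-(q^3)) (-(q^5)) (- int n - 1)"
proof -
  have q2: "norm (q\<^sup>2) < 1" and mq: "norm (-q) < 1"
    using norm_power2_less_one[OF q] q by auto
  define t u w where "t = nat (tri (int n))" and "u = nat (tri (int n - 1))" and "w = nat (tri (int n + 1))"
  have t: "int t = tri (int n)" and u: "int u = tri (int n - 1)" and w: "int w = tri (int n + 1)"
    by (simp_all add: t_def u_def w_def tri_nonneg)
  have "tri (- int n - 1) = tri (int n)" "tri (- int n - 1 - 1) = tri (int n + 1)"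
    by (simp_all add: tri_def algebra_simps)
  then have th: "theta_term a b (int n) = a ^ t * b ^ u" "theta_term a b (- int n - 1) = a ^ t * b ^ w" for a b
    by (simp_all add: theta_term_def t_def u_def w_def)
  have t2: "2 * int t = int n * int n + int n" and u2: "2 * int u = int n * int n - int n"
    and w2: "2 * int w = int n * int n + 3 * int n + 2"
    using tri_double[of "int n"] tri_double[of "int n - 1"] tri_double[of "int n + 1"] t u w
    by (simp_all add: algebra_simps)
  have "int (t + u) = int (n * n)" using t2 u2 by simp
  then have tu: "t + u = n * n" by (simp only: of_nat_eq_iff)
  have "int (t + w) = int (n * n + 2 * n + 1)" using t2 w2 by simp
  then have tw: "t + w = n * n + 2 * n + 1" by (simp only: of_nat_eq_iff)
  have "int (3 * t + 5 * u + n) = int (4 * (n * n))" using t2 u2 by simp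
  then have "3 * t + 5 * u + n = 4 * (n * n)" by (simp only: of_nat_eq_iff)
  then have e1: "3 * t + 5 * u = 4 * n\<^sup>2 - n" by (simp add: power2_eq_square)
  have "w = u + 2 * n + 1" using tu tw by simp
  then have e2: "3 * t + 5 * w = (4 * n\<^sup>2 - n) + (5 + 2 * n * 5)"
    using e1 by simp
  \<comment> \<open>\<open>t + u = n * n\<close> has the parity of \<open>n\<close>, while
    \<open>t + w\<close> is the square of \<open>n + 1\<close>.\<close>
  have sgn1: "(-1 :: complex) ^ (t + u) = (-1) ^ n"
    unfolding tu by (simp add: minus_one_power_iff)
  have sgn2: "(-1 :: complex) ^ (t + w) = - ((-1) ^ n)"
    unfolding tw by (simp add: minus_one_power_iff)
  have pm: "(-(q^3)) ^ i * (-(q^5)) ^ j = (-1) ^ (i + j) * q ^ (3 * i + 5 * j)" for i j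
    unfolding power_minus[of "q^3" i] power_minus[of "q^5" j] power_add power_mult by (simp only: mult_ac)
  have "1 - (-q) * (q\<^sup>2) ^ n \<noteq> 0"
    by (rule one_minus_mult_power_nonzero[OF q2 mq])
  then have nz: "1 + q * q ^ (2 * n) \<noteq> 0" by (simp add: power_mult)
  have "gg_weight q 0 n = (-1) ^ n * q ^ (4 * n\<^sup>2 - n) / (1 + q * q ^ (2 * n))"
    using qpoch_nonzero[OF q2 q2, of n] qpoch_nonzero[OF q2 mq, of n]
    by (simp add: gg_weight_def qpoch_Suc power_mult)
  then have "gg_term q 0 n = (-1) ^ n * q ^ (4 * n\<^sup>2 - n) / (1 + q * q ^ (2 * n))
      * ((1 + q * q ^ (2 * n)) * (1 - q ^ 5 * (q ^ (2 * n)) ^ 5))"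
    unfolding gg_term_def by (simp add: algebra_simps)
  also have "\<dots> = (-1) ^ n * q ^ (4 * n\<^sup>2 - n) * (1 - q ^ 5 * (q ^ (2 * n)) ^ 5)"
    using nz by simp
  also have "\<dots> = (-1) ^ n * q ^ (4 * n\<^sup>2 - n) + - ((-1) ^ n) * q ^ ((4 * n\<^sup>2 - n) + (5 + 2 * n * 5))"
    by (simp only: power_add power_mult) (simp add: algebra_simps)
  finally show ?thesis
    unfolding th pm sgn1 sgn2 e1 e2 .
qed

text \<open>Fact \<open>a\<close> expresses \<open>qpoch_inf (-q) (q\<^sup>2)\<close> by symbols
  without sign. Splitting by parity then leads to base \<open>q^8\<close>; the common factor
  \<open>qpoch_inf (q\<^sup>2) (q^4)\<close> and the symbols for \<open>q^3\<close>,
  \<open>q^5\<close> and \<open>q^8\<close> cancel.\<close>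

lemma gg_product:
  assumes q: "norm q < 1"
  shows "qpoch_inf (-q) (q\<^sup>2) / qpoch_inf (q\<^sup>2) (q\<^sup>2) *
      (qpoch_inf (q^8) (q^8) * qpoch_inf (q^3) (q^8) * qpoch_inf (q^5) (q^8))
    = 1 / (qpoch_inf q (q^8) * qpoch_inf (q^4) (q^8) * qpoch_inf (q^7) (q^8))"
proof -
  have n: "norm (q ^ k) < 1" if "k > 0" for k
    using q that by (simp add: norm_power power_less_one_iff)
  have nz: "qpoch_inf (q ^ k) (q ^ l) \<noteq> 0" if "k > 0" "l > 0" for k l
    by (intro qpoch_inf_nonzero n that)
  note parity = qpoch_inf_split_parity[OF n]
  have a: "qpoch_inf (-q) (q\<^sup>2) * qpoch_inf q (q\<^sup>2) = qpoch_inf (q\<^sup>2) (q^4)"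
    using qpoch_inf_mult_uminus[OF n[of 2], of q] by simp
  have b: "qpoch_inf (q\<^sup>2) (q\<^sup>2) = qpoch_inf (q\<^sup>2) (q^4) * qpoch_inf (q^4) (q^4)"
    using parity[of 2 "q\<^sup>2"] by (simp flip: power_add)
  have c: "qpoch_inf (q^4) (q^4) = qpoch_inf (q^4) (q^8) * qpoch_inf (q^8) (q^8)"
    using parity[of 4 "q^4"] by (simp flip: power_add power_mult)
  have d: "qpoch_inf q (q\<^sup>2) = qpoch_inf q (q^4) * qpoch_inf (q^3) (q^4)"
    using parity[of 2 q] by (simp flip: power_Suc)
  have e: "qpoch_inf q (q^4) = qpoch_inf q (q^8) * qpoch_inf (q^5) (q^8)"
    using parity[of 4 q] by (simp flip: power_Suc power_mult)
  have f: "qpoch_inf (q^3) (q^4) = qpoch_inf (q^3) (q^8) * qpoch_inf (q^7) (q^8)"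
    using parity[of 4 "q^3"] by (simp flip: power_add power_mult)
  have nz1: "qpoch_inf q (q^8) \<noteq> 0" "qpoch_inf q (q\<^sup>2) \<noteq> 0" using nz[of 1 8] nz[of 1 2] by simp_all
  have "qpoch_inf (-q) (q\<^sup>2) = qpoch_inf (q\<^sup>2) (q^4) / (qpoch_inf q (q^8) * qpoch_inf (q^5) (q^8) *
      (qpoch_inf (q^3) (q^8) * qpoch_inf (q^7) (q^8)))"
    using a nz1(2) unfolding d[unfolded e f] by (simp add: field_simps)
  then show ?thesis
    unfolding b c using nz nz1 by simp
qed

section \<open>Comparison of the three solutions at \<open>m = 0\<close>\<close>

theorem theorem5:
  fixes q :: complex
  assumes "norm q < 1"
  shows "((\<lambda>xs. q ^ sum_list xs) has_sum
            (1 / (qpoch_inf q (q^8) * qpoch_inf (q^4) (q^8) * qpoch_inf (q^7) (q^8))))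
           {xs. G_partition xs} \<and>
         (\<lambda>n. qpoch (-q) (q^2) n * q ^ (n^2) / qpoch (q^2) (q^2) n) sums
            (1 / (qpoch_inf q (q^8) * qpoch_inf (q^4) (q^8) * qpoch_inf (q^7) (q^8)))"
proof -
  let ?P = "1 / (qpoch_inf q (q^8) * qpoch_inf (q^4) (q^8) * qpoch_inf (q^7) (q^8))"
  \<comment> \<open>\<open>C\<close> is the reciprocal of the limit of \<open>gg_sum q\<close>, so
    that \<open>F\<close> tends to 1 like the other two solutions.\<close>
  define C where "C = qpoch_inf (-q) (q\<^sup>2) / qpoch_inf (q\<^sup>2) (q\<^sup>2)"
  define F where "F = (\<lambda>m. C * gg_sum q m)"
  have q2: "norm (q\<^sup>2) < 1" and mq: "norm (-q) < 1"
    using norm_power2_less_one[OF assms] assms by auto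
  have F_rec: "F m = (1 + q ^ (2*m+1)) * F (m+1) + q ^ (2*m+2) * F (m+2)" for m
    unfolding F_def gg_sum_rec[OF assms, of m] by (simp only: distrib_left mult_ac)
  have "F \<longlonglongrightarrow> C * (qpoch_inf (q\<^sup>2) (q\<^sup>2) / qpoch_inf (-q) (q\<^sup>2))"
    unfolding F_def by (intro tendsto_mult tendsto_const gg_sum_LIMSEQ assms)
  then have F_lim: "F \<longlonglongrightarrow> 1"
    using qpoch_inf_nonzero[OF q2 q2] qpoch_inf_nonzero[OF q2 mq] by (simp add: C_def)
  \<comment> \<open>For \<open>a = -(q^3)\<close> and \<open>b = -(q^5)\<close> the base
    \<open>a * b\<close> is \<open>q^8\<close>, and the triple product yields the three symbols that
    \<open>gg_product\<close> cancels.\<close>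
  have "norm (-(q^3)) < 1" "norm (-(q^5)) < 1"
    using assms by (simp_all add: norm_power power_less_one_iff)
  from jacobi_triple_product[OF this]
  have "gg_term q 0 sums (qpoch_inf (q^8) (q^8) * qpoch_inf (q^3) (q^8) * qpoch_inf (q^5) (q^8))"
    unfolding gg_term_0_eq_theta[OF assms, symmetric] by (simp flip: power_add)
  then have F0: "F 0 = ?P"
    unfolding F_def gg_sum_def C_def gg_product[OF assms, symmetric] by (simp add: sums_iff)
  have "G_gf q 0 = ?P"
    unfolding F0[symmetric]
    by (rule gg_recurrence_unique[OF assms G_gf_rec[OF assms] G_gf_LIMSEQ[OF assms] F_rec F_lim])
  moreover have "gg_series q 0 = ?P"
    unfolding F0[symmetric]
    by (rule gg_recurrence_unique[OF assms gg_series_rec[OF assms] gg_series_LIMSEQ[OF assms] F_rec F_lim])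
  moreover have "(\<lambda>n. qpoch (-q) (q^2) n * q ^ (n^2) / qpoch (q^2) (q^2) n) sums gg_series q 0"
    using summable_sums[OF gg_series_summable[OF assms, of 0]] by (simp add: gg_series_def gg_coeff_def)
  ultimately show ?thesis
    using G_gf_has_sum[OF assms, of 0] by (simp add: G_above_0)
qed

end
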